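(* Let $X$ be a sofic shift. The generalized left Fischer cover $(G,\mathcal{L}_G)$ of $X$ and the left Krieger cover $(K,\mathcal{L}_K)$ of $X$ are both foundations of the past set cover $(W,\mathcal{L}_W)$ of $X$.
   Context: A shift space is a closed subset $X\subseteq\mathcal{A}^{\mathbb{Z}}$ ($\mathcal{A}$ a finite discrete alphabet, product topology) invariant under the shift $\sigma(x)_i=x_{i+1}$. It is sofic if it is the image of a shift of finite type under a continuous shift-commuting map. $\mathcal{B}(X)$ is the set of (nonempty) finite words occurring in elements of $X$. $X^+=\{x_0x_1x_2\cdots : x\in X\}$ and $X^-=\{\cdots x_{-2}x_{-1} : x\in X\}$. For $x^+\in X^+$, $P_\infty(x^+)=\{y^-\in X^- : y^-x^+\in X\}$; for $w\in\mathcal{B}(X)$, $P_\infty(w)=\{y^-\in X^- : y^-w\in X^-\}$. Covers. The left Krieger cover $(K,\mathcal{L}_K)$ of $X$ is the labelled directed graph with vertex set $K^0=\{P_\infty(x^+) : x^+\in X^+\}$ which has an edge labelled $a\in\mathcal{A}$ from $P$ to $P'$ if and only if there is $x^+\in X^+$ with $ax^+\in X^+$, $P=P_\infty(ax^+)$ and $P'=P_\infty(x^+)$. The past set cover $(W,\mathcal{L}_W)$ is the labelled directed graph with vertex set $W^0=\{P_\infty(w) : w\in\mathcal{B}(X)\}$ which has an edge labelled $a$ from $P$ to $P'$ if and only if there is $w\in\mathcal{B}(X)$ with $aw\in\mathcal{B}(X)$, $P=P_\infty(aw)$ and $P'=P_\infty(w)$. Both are finite since $X$ is sofic. For vertices,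 $u\geq v$ means that there is a path (possibly of length $0$) from $u$ to $v$. A vertex $P\in K^0$ is non-decomposable if whenever $V\subseteq K^0$ and $P=\bigcup_{Q\in V}Q$, then $P\in V$. The generalized left Fischer cover $(G,\mathcal{L}_G)$ of $X$ is the labelled subgraph of $(K,\mathcal{L}_K)$ with vertex set $G^0=\{P\in K^0 : P\geq P' \text{ for some non-decomposable } P'\in K^0\}$ and all edges with both endpoints in $G^0$. Foundations. A labelled graph $\mathcal{E}=(E,\mathcal{L})$ is left-resolving if no vertex receives two edges with the same label, and predecessor-separated if distinct vertices $u\neq v$ have $P^E_\infty(u)\neq P^E_\infty(v)$, where $P^E_\infty(v)$ is the set of label sequences of left-infinite paths terminating at $v$. Let $\mathcal{E}$ be finite, left-resolving and predecessor-separated. For $V\subseteq E^0$ and $a\in\mathcal{A}$ let $aV$ be the set of sources of edges labelled $a$ terminating in $V$. Let $S$ be a set of nonempty subsets of $E^0$ and $\sim$ an equivalence relation on $S$. $(S,\sim)$ is past closed if for all $u,v\in E^0$, $U,V\in S$, $a\in\mathcal{A}$: (1) $\{v\}\in S$; (2) $\{u\}\sim\{v\}$ implies $u=v$; (3) $aV\neq\emptyset$ implies $aV\in S$; (4) $U\sim V$ and $aU\neq\emptyset$ imply $aV\neq\emptyset$ and $aU\sim aV$. For $(S,\sim)$ past closed, $\mathcal{G}(\mathcal{E},S,\sim)$ is the labelled graph with vertex set $S/{\sim}$ which has an edge labelled $a$ from $[aV]$ to $[V]$ whenever $aV\neq\emptyset$ ($[V]$ is the $\sim$-class of $V\in S$).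 $\mathcal{E}$ is a foundation of a labelled graph $\mathcal{H}$ if $\mathcal{H}$ is labelled graph isomorphic to $\mathcal{G}(\mathcal{E},S,\sim)$ for some past closed $(S,\sim)$. *)

theory Defs
  imports "HOL-Analysis.Analysis" "Graph_Theory.Graph_Theory"
begin

section \<open>Shift spaces\<close>

text \<open>The alphabet is an explicit finite carrier set \<open>A\<close>, not a type: the definition of soficity
  quantifies over the alphabet of a second shift.\<close>

definition full_shift :: "'a set \<Rightarrow> (int \<Rightarrow> 'a) topology" where
  "full_shift A = product_topology (\<lambda>_. discrete_topology A) UNIV"

definition shift_map :: "(int \<Rightarrow> 'a) \<Rightarrow> int \<Rightarrow> 'a" where
  "shift_map x = (\<lambda>i. x (i + 1))"

definition shift_space :: "'a set \<Rightarrow> (int \<Rightarrow> 'a) set \<Rightarrow> bool" where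
  "shift_space A X \<longleftrightarrow> finite A \<and> closedin (full_shift A) X \<and> shift_map ` X = X"

definition occurs :: "'a list \<Rightarrow> (int \<Rightarrow> 'a) \<Rightarrow> bool" where
  "occurs w x \<longleftrightarrow> (\<exists>i j. w = map x [i..j])"

definition finite_type :: "'a set \<Rightarrow> (int \<Rightarrow> 'a) set \<Rightarrow> bool" where
  "finite_type A X \<longleftrightarrow> finite A \<and>
     (\<exists>F. finite F \<and> F \<subseteq> lists A \<and> X = {x \<in> topspace (full_shift A). \<forall>w\<in>F. \<not> occurs w x})"

text \<open>Taking the alphabet \<open>B\<close> of the covering shift of finite type inside \<^typ>\<open>nat\<close> loses no
  generality, since every finite alphabet is in bijection with a finite set of natural numbers.\<close>

definition sofic :: "'a set \<Rightarrow> (int \<Rightarrow> 'a) set \<Rightarrow> bool" where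
  "sofic A X \<longleftrightarrow> shift_space A X \<and>
     (\<exists>(B :: nat set) Y \<phi>. finite_type B Y \<and>
        continuous_map (subtopology (full_shift B) Y) (full_shift A) \<phi> \<and>
        (\<forall>y\<in>Y. \<phi> (shift_map y) = shift_map (\<phi> y)) \<and> \<phi> ` Y = X)"

definition words :: "(int \<Rightarrow> 'a) set \<Rightarrow> 'a list set" where
  "words X = {w. w \<noteq> [] \<and> (\<exists>x\<in>X. occurs w x)}"

section \<open>Rays and predecessor sets\<close>

text \<open>A right ray $x_0 x_1 x_2 \cdots$ is the function \<open>\<lambda>n. x\<^sub>n\<close>. A left ray
  $\cdots y_{-3} y_{-2} y_{-1}$ is read from right to left: it is the function whose value at \<open>n\<close>
  is the symbol at position \<open>-n - 1\<close>.\<close>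

type_synonym 'a right_ray = "nat \<Rightarrow> 'a"
type_synonym 'a left_ray = "nat \<Rightarrow> 'a"

definition right_rays :: "(int \<Rightarrow> 'a) set \<Rightarrow> 'a right_ray set" where
  "right_rays X = {\<lambda>n. x (int n) |x. x \<in> X}"

definition left_rays :: "(int \<Rightarrow> 'a) set \<Rightarrow> 'a left_ray set" where
  "left_rays X = {\<lambda>n. x (- int n - 1) |x. x \<in> X}"

definition join_rays :: "'a left_ray \<Rightarrow> 'a right_ray \<Rightarrow> int \<Rightarrow> 'a" where
  "join_rays y x = (\<lambda>i. if i < 0 then y (nat (- i - 1)) else x (nat i))"

definition cons_ray :: "'a \<Rightarrow> 'a right_ray \<Rightarrow> 'a right_ray" where
  "cons_ray a x = case_nat a x"

definition append_word :: "'a left_ray \<Rightarrow> 'a list \<Rightarrow> 'a left_ray" where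
  "append_word y w = (\<lambda>n. if n < length w then rev w ! n else y (n - length w))"

definition past_of_ray :: "(int \<Rightarrow> 'a) set \<Rightarrow> 'a right_ray \<Rightarrow> 'a left_ray set" where
  "past_of_ray X x = {y \<in> left_rays X. join_rays y x \<in> X}"

definition past_of_word :: "(int \<Rightarrow> 'a) set \<Rightarrow> 'a list \<Rightarrow> 'a left_ray set" where
  "past_of_word X w = {y \<in> left_rays X. append_word y w \<in> left_rays X}"

section \<open>Labelled graphs\<close>

type_synonym ('v, 'e, 'a) labelled_graph = "('v, 'e) pre_digraph \<times> ('e \<Rightarrow> 'a)"

text \<open>The graph with vertex set \<open>V\<close> and, for each \<open>(u, a, v) \<in> T\<close>, exactly one edge labelled \<open>a\<close>
  from \<open>u\<close> to \<open>v\<close>.\<close>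

definition graph_of_triples ::
    "'v set \<Rightarrow> ('v \<times> 'a \<times> 'v) set \<Rightarrow> ('v, 'v \<times> 'a \<times> 'v, 'a) labelled_graph" where
  "graph_of_triples V T =
     (\<lparr>verts = V, arcs = T, tail = (\<lambda>(u, a, v). u), head = (\<lambda>(u, a, v). v)\<rparr>, \<lambda>(u, a, v). a)"

fun labelled_graph_isomorphic ::
    "('v, 'e, 'a) labelled_graph \<Rightarrow> ('w, 'f, 'a) labelled_graph \<Rightarrow> bool" where
  "labelled_graph_isomorphic (E, L) (H, M) \<longleftrightarrow>
     (\<exists>f. pre_digraph.digraph_isomorphism E f \<and> H = app_iso f E \<and>
          (\<forall>e\<in>arcs E. M (iso_arcs f e) = L e))"

fun left_resolving :: "('v, 'e, 'a) labelled_graph \<Rightarrow> bool" where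
  "left_resolving (E, L) \<longleftrightarrow>
     (\<forall>e\<in>arcs E. \<forall>f\<in>arcs E. head E e = head E f \<and> L e = L f \<longrightarrow> e = f)"

text \<open>The \<open>n\<close>-th edge of a left-infinite path is, like the \<open>n\<close>-th symbol of a left ray, counted
  from the right end.\<close>

fun pasts :: "('v, 'e, 'a) labelled_graph \<Rightarrow> 'v \<Rightarrow> 'a left_ray set" where
  "pasts (E, L) v =
     {\<lambda>n. L (p n) |p. (\<forall>n. p n \<in> arcs E) \<and> head E (p 0) = v \<and>
                       (\<forall>n. head E (p (Suc n)) = tail E (p n))}"

fun predecessor_separated :: "('v, 'e, 'a) labelled_graph \<Rightarrow> bool" where
  "predecessor_separated (E, L) \<longleftrightarrow> inj_on (pasts (E, L)) (verts E)"

section \<open>Covers\<close>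

definition Krieger_vertices :: "(int \<Rightarrow> 'a) set \<Rightarrow> 'a left_ray set set" where
  "Krieger_vertices X = past_of_ray X ` right_rays X"

definition left_Krieger_cover ::
    "(int \<Rightarrow> 'a) set \<Rightarrow>
     ('a left_ray set, 'a left_ray set \<times> 'a \<times> 'a left_ray set, 'a) labelled_graph" where
  "left_Krieger_cover X = graph_of_triples (Krieger_vertices X)
     {(past_of_ray X (cons_ray a x), a, past_of_ray X x) |a x.
        x \<in> right_rays X \<and> cons_ray a x \<in> right_rays X}"

definition past_set_cover ::
    "(int \<Rightarrow> 'a) set \<Rightarrow>
     ('a left_ray set, 'a left_ray set \<times> 'a \<times> 'a left_ray set, 'a) labelled_graph" where
  "past_set_cover X = graph_of_triples (past_of_word X ` words X)
     {(past_of_word X (a # w), a, past_of_word X w) |a w. w \<in> words X \<and> a # w \<in> words X}"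

definition non_decomposable :: "(int \<Rightarrow> 'a) set \<Rightarrow> 'a left_ray set \<Rightarrow> bool" where
  "non_decomposable X P \<longleftrightarrow> P \<in> Krieger_vertices X \<and>
     (\<forall>V \<subseteq> Krieger_vertices X. P = \<Union>V \<longrightarrow> P \<in> V)"

definition Fischer_vertices :: "(int \<Rightarrow> 'a) set \<Rightarrow> 'a left_ray set set" where
  "Fischer_vertices X = {P \<in> Krieger_vertices X.
     \<exists>P'. non_decomposable X P' \<and> P \<rightarrow>\<^sup>*\<^bsub>fst (left_Krieger_cover X)\<^esub> P'}"

definition generalized_left_Fischer_cover ::
    "(int \<Rightarrow> 'a) set \<Rightarrow>
     ('a left_ray set, 'a left_ray set \<times> 'a \<times> 'a left_ray set, 'a) labelled_graph" where
  "generalized_left_Fischer_cover X =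
     (fst (left_Krieger_cover X) \<restriction> Fischer_vertices X, snd (left_Krieger_cover X))"

section \<open>Foundations\<close>

fun preimage :: "('v, 'e, 'a) labelled_graph \<Rightarrow> 'a \<Rightarrow> 'v set \<Rightarrow> 'v set" where
  "preimage (E, L) a V = {tail E e |e. e \<in> arcs E \<and> L e = a \<and> head E e \<in> V}"

definition past_closed ::
    "('v, 'e, 'a) labelled_graph \<Rightarrow> 'v set set \<Rightarrow> ('v set \<times> 'v set) set \<Rightarrow> bool" where
  "past_closed \<E> S R \<longleftrightarrow>
     S \<subseteq> Pow (verts (fst \<E>)) - {{}} \<and> equiv S R \<and>
     (\<forall>v\<in>verts (fst \<E>). {v} \<in> S) \<and>
     (\<forall>u\<in>verts (fst \<E>). \<forall>v\<in>verts (fst \<E>). ({u}, {v}) \<in> R \<longrightarrow> u = v) \<and>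
     (\<forall>V\<in>S. \<forall>a. preimage \<E> a V \<noteq> {} \<longrightarrow> preimage \<E> a V \<in> S) \<and>
     (\<forall>U\<in>S. \<forall>V\<in>S. \<forall>a. (U, V) \<in> R \<and> preimage \<E> a U \<noteq> {} \<longrightarrow>
        preimage \<E> a V \<noteq> {} \<and> (preimage \<E> a U, preimage \<E> a V) \<in> R)"

definition generated_graph ::
    "('v, 'e, 'a) labelled_graph \<Rightarrow> 'v set set \<Rightarrow> ('v set \<times> 'v set) set \<Rightarrow>
     ('v set set, 'v set set \<times> 'a \<times> 'v set set, 'a) labelled_graph" where
  "generated_graph \<E> S R = graph_of_triples (S // R)
     {(R `` {preimage \<E> a V}, a, R `` {V}) |a V. V \<in> S \<and> preimage \<E> a V \<noteq> {}}"

text \<open>The standing assumptions on \<open>\<E>\<close> are part of the notion of a foundation.\<close>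

definition foundation ::
    "('v, 'e, 'a) labelled_graph \<Rightarrow> ('w, 'f, 'a) labelled_graph \<Rightarrow> bool" where
  "foundation \<E> \<H> \<longleftrightarrow>
     fin_digraph (fst \<E>) \<and> left_resolving \<E> \<and> predecessor_separated \<E> \<and>
     (\<exists>S R. past_closed \<E> S R \<and> labelled_graph_isomorphic \<H> (generated_graph \<E> S R))"

end

theory Submission
  imports Defs
begin

text \<open>
  Write $P a^{-1} = \{y : ya \in P\}$ for a set $P$ of left rays. Predecessor sets are governed by
  this one operation: $P_\infty(ax^+) = P_\infty(x^+) a^{-1}$ and
  $P_\infty(aw) = P_\infty(w) a^{-1}$, and a ray or a word occurs in $X$ exactly if its
  predecessor set is nonempty. So in the left Krieger cover and in the past set cover alike, a
  vertex $P$ receives an edge labelled $a$ iff $P a^{-1} \neq \emptyset$, and then exactly one, from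
  $P a^{-1}$. Since $(\bigcup V) a^{-1} = \bigcup_{P \in V} P a^{-1}$, taking the union of a set of
  vertices commutes with taking its $a$-preimage.

  This suggests what to identify. Let $H$ be a set of Krieger vertices closed under nonempty
  preimages such that each Krieger vertex is a union of members of $H$. Take for $S$ the nonempty
  $V \subseteq H$ whose union is some $P_\infty(w)$, and let $U \sim V$ iff $\bigcup U = \bigcup V$.
  Then $V \mapsto \bigcup V$ induces an isomorphism onto the past set cover
  (\<open>foundation_part\<close>): it is onto because $P_\infty(w)$ is the union of the $P_\infty(x^+)$
  over the rays $x^+$ that begin with $w$. All Krieger vertices form such a set $H$. The vertices of
  the generalized left Fischer cover form another one: they are closed under preimages by
  definition, and in a finite family of sets each member is a union of non-decomposable ones.

  The dynamics enters in three places. The sofic hypothesis gives finiteness of the Krieger cover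
  (\<open>finite_Krieger_vertices\<close>). Finiteness and compactness show that each $P_\infty(x^+)$ is already
  some $P_\infty(w)$ (\<open>past_of_ray_is_past_of_word\<close>), so that singletons belong to $S$.
  Finally, $X$ being closed, the left-infinite paths into a vertex $P$ spell exactly the rays in
  $P$ (\<open>pasts_part\<close>), so the cover is predecessor-separated.
\<close>

section \<open>Full shifts and their topology\<close>

definition agree :: "nat \<Rightarrow> (int \<Rightarrow> 'a) \<Rightarrow> (int \<Rightarrow> 'a) \<Rightarrow> bool" where
  "agree n x z \<longleftrightarrow> (\<forall>i. \<bar>i\<bar> \<le> int n \<longrightarrow> z i = x i)"

definition shift_by :: "int \<Rightarrow> (int \<Rightarrow> 'a) \<Rightarrow> int \<Rightarrow> 'a" where
  "shift_by k x = (\<lambda>i. x (i + k))"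

lemma shift_by_0 [simp]: "shift_by 0 x = x"
  by (simp add: shift_by_def)

lemma shift_by_shift_by [simp]: "shift_by k (shift_by l x) = shift_by (k + l) x"
  by (simp add: shift_by_def add.assoc)

lemma shift_map_eq_shift_by: "shift_map x = shift_by 1 x"
  by (simp add: shift_map_def shift_by_def)

lemma topspace_full_shift: "topspace (full_shift A) = {x. \<forall>i. x i \<in> A}"
  by (auto simp: full_shift_def PiE_def Pi_def)

text \<open>The symmetric cylinders form a basis of the product topology; all later topological arguments
  are reduced to this description of the open sets.\<close>

lemma openin_full_shift_iff:
  "openin (full_shift A) S \<longleftrightarrow> S \<subseteq> topspace (full_shift A) \<and>
     (\<forall>x\<in>S. \<exists>n. \<forall>z\<in>topspace (full_shift A). agree n x z \<longrightarrow> z \<in> S)"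
proof (intro iffI conjI ballI)
  assume S: "openin (full_shift A) S"
  then show "S \<subseteq> topspace (full_shift A)"
    by (rule openin_subset)
  fix x assume "x \<in> S"
  with S obtain U where fin: "finite {i \<in> UNIV. U i \<noteq> A}"
    and xU: "x \<in> Pi\<^sub>E UNIV U" and US: "Pi\<^sub>E UNIV U \<subseteq> S"
    unfolding full_shift_def openin_product_topology_alt by fastforce
  define n where "n = Max ((\<lambda>i. nat \<bar>i\<bar>) ` {i \<in> UNIV. U i \<noteq> A})"
  have bound: "nat \<bar>i\<bar> \<le> n" if "U i \<noteq> A" for i
    unfolding n_def using fin that by (intro Max_ge) auto
  have "z \<in> S" if z: "z \<in> topspace (full_shift A)" and "agree n x z" for z
  proof -
    have "z i \<in> U i" for i
    proof (cases "U i = A")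
      case True
      then show ?thesis using z by (simp add: topspace_full_shift)
    next
      case False
      then have "z i = x i"
        using bound[of i] \<open>agree n x z\<close> by (auto simp: agree_def)
      then show ?thesis using xU by auto
    qed
    then show ?thesis using US by auto
  qed
  then show "\<exists>n. \<forall>z\<in>topspace (full_shift A). agree n x z \<longrightarrow> z \<in> S" by blast
next
  assume S: "S \<subseteq> topspace (full_shift A) \<and>
     (\<forall>x\<in>S. \<exists>n. \<forall>z\<in>topspace (full_shift A). agree n x z \<longrightarrow> z \<in> S)"
  show "openin (full_shift A) S"
    unfolding full_shift_def openin_product_topology_alt
  proof
    fix x assume x: "x \<in> S"
    with S obtain n where n: "\<And>z. z \<in> topspace (full_shift A) \<Longrightarrow> agree n x z \<Longrightarrow> z \<in> S"
      by blast
    have xA: "x i \<in> A" for i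
      using x S by (auto simp: topspace_full_shift)
    define U where "U i = (if \<bar>i\<bar> \<le> int n then {x i} else A)" for i
    have "{i. U i \<noteq> A} \<subseteq> {- int n..int n}"
      by (auto simp: U_def split: if_splits)
    then have "finite {i. U i \<noteq> A}" by (rule finite_subset) simp
    moreover have "Pi\<^sub>E UNIV U \<subseteq> S"
    proof
      fix z assume z: "z \<in> Pi\<^sub>E UNIV U"
      have zU: "z i \<in> U i" for i using z by auto
      have "z i \<in> A" for i
        using zU[of i] xA[of i] by (auto simp: U_def split: if_splits)
      moreover have "agree n x z"
        unfolding agree_def
      proof (intro allI impI)
        fix i :: int assume "\<bar>i\<bar> \<le> int n"
        then show "z i = x i" using zU[of i] by (simp add: U_def)
      qed
      ultimately show "z \<in> S" by (intro n) (auto simp: topspace_full_shift)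
    qed
    moreover have "x \<in> Pi\<^sub>E UNIV U" using xA by (auto simp: U_def)
    moreover have "\<forall>i. U i \<subseteq> A" using xA by (auto simp: U_def)
    ultimately show "\<exists>U. finite {i \<in> UNIV. U i \<noteq> topspace (discrete_topology A)} \<and>
        (\<forall>i\<in>UNIV. openin (discrete_topology A) (U i)) \<and> x \<in> Pi\<^sub>E UNIV U \<and> Pi\<^sub>E UNIV U \<subseteq> S"
      by auto
  qed
qed

lemma compact_space_full_shift:
  assumes "finite A" shows "compact_space (full_shift A)"
  unfolding full_shift_def compact_space_product_topology
  using assms by (simp add: compact_space_discrete_topology)

section \<open>Finitely many pasts in a sofic shift\<close>

lemma finite_type_shift_by:
  assumes "finite_type B Y" and y: "y \<in> Y"
  shows "shift_by k y \<in> Y"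
proof -
  from assms obtain F where Y: "Y = {x \<in> topspace (full_shift B). \<forall>w\<in>F. \<not> occurs w x}"
    by (auto simp: finite_type_def)
  have "occurs w y" if "occurs w (shift_by k y)" for w
  proof -
    from that obtain i j where w: "w = map (shift_by k y) [i..j]"
      by (auto simp: occurs_def)
    have "w = map y [i + k..j + k]"
      unfolding w by (rule nth_equalityI) (auto simp: shift_by_def algebra_simps)
    then show ?thesis by (auto simp: occurs_def)
  qed
  then show ?thesis using y unfolding Y by (auto simp: topspace_full_shift shift_by_def)
qed

lemma closedin_finite_type:
  assumes "finite_type B Y" shows "closedin (full_shift B) Y"
proof -
  from assms obtain F where Y: "Y = {x \<in> topspace (full_shift B). \<forall>w\<in>F. \<not> occurs w x}"
    by (auto simp: finite_type_def)
  have "openin (full_shift B) (topspace (full_shift B) - Y)"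
    unfolding openin_full_shift_iff
  proof (intro conjI ballI)
    fix x assume "x \<in> topspace (full_shift B) - Y"
    then obtain w i j where w: "w \<in> F" "w = map x [i..j]"
      unfolding Y by (auto simp: occurs_def)
    define n where "n = nat (max \<bar>i\<bar> \<bar>j\<bar>)"
    have "z \<notin> Y" if "agree n x z" for z
    proof -
      have "w = map z [i..j]"
        unfolding w(2)
      by (intro map_cong refl) (use that in \<open>auto simp: agree_def n_def abs_le_iff max_def split: if_splits\<close>)
      then show ?thesis using w(1) by (auto simp: Y occurs_def)
    qed
    then show "\<exists>n. \<forall>z\<in>topspace (full_shift B). agree n x z \<longrightarrow> z \<in> topspace (full_shift B) - Y"
      by blast
  qed auto
  then show ?thesis by (auto simp: closedin_def Y)
qed

text \<open>The half of the Curtis--Hedlund--Lyndon theorem that extracts a local rule: continuity gives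
  each point a cylinder on which the symbol at \<open>0\<close> is constant, and by compactness finitely many
  of these cylinders suffice, so that their sizes have a maximum.\<close>

lemma continuous_map_depends_on_window:
  assumes Y: "compactin (full_shift B) Y"
    and cont: "continuous_map (subtopology (full_shift B) Y) (full_shift A) \<phi>"
  obtains N where "\<And>y z. y \<in> Y \<Longrightarrow> z \<in> Y \<Longrightarrow> agree N y z \<Longrightarrow> \<phi> y 0 = \<phi> z 0"
proof -
  have YB: "Y \<subseteq> topspace (full_shift B)"
    using Y by (rule compactin_subset_topspace)
  define cyl where "cyl n y = {z \<in> topspace (full_shift B). agree n y z}" for n and y :: "int \<Rightarrow> 'a"
  have opencyl: "openin (full_shift B) (cyl n y)" for n y
    unfolding openin_full_shift_iff cyl_def by (auto simp: agree_def intro!: exI[of _ n])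
  have "\<exists>n. \<forall>z\<in>Y. agree n y z \<longrightarrow> \<phi> z 0 = \<phi> y 0" if y: "y \<in> Y" for y
  proof -
    have "openin (full_shift A) {w \<in> topspace (full_shift A). w 0 = \<phi> y 0}"
      unfolding openin_full_shift_iff by (auto simp: agree_def intro!: exI[of _ 0])
    with cont have "openin (subtopology (full_shift B) Y)
        {z \<in> topspace (subtopology (full_shift B) Y). \<phi> z \<in> {w \<in> topspace (full_shift A). w 0 = \<phi> y 0}}"
      by (rule openin_continuous_map_preimage)
    then obtain T where T: "openin (full_shift B) T"
      and eq: "{z \<in> topspace (subtopology (full_shift B) Y). \<phi> z \<in> {w \<in> topspace (full_shift A). w 0 = \<phi> y 0}} = T \<inter> Y"
      unfolding openin_subtopology by blast
    have "\<phi> y \<in> topspace (full_shift A)"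
      using cont y YB by (auto simp: continuous_map_def Pi_def)
    then have "y \<in> T" using eq y YB by auto
    with T obtain n where "\<forall>z\<in>topspace (full_shift B). agree n y z \<longrightarrow> z \<in> T"
      unfolding openin_full_shift_iff by blast
    then have "\<forall>z\<in>Y. agree n y z \<longrightarrow> \<phi> z 0 = \<phi> y 0" using eq YB by blast
    then show ?thesis ..
  qed
  then obtain n where n: "\<And>y z. y \<in> Y \<Longrightarrow> z \<in> Y \<Longrightarrow> agree (n y) y z \<Longrightarrow> \<phi> z 0 = \<phi> y 0"
    by metis
  have "Y \<subseteq> (\<Union>y\<in>Y. cyl (n y) y)"
    using YB by (auto simp: cyl_def agree_def)
  then obtain \<F> where \<F>: "finite \<F>" "\<F> \<subseteq> (\<lambda>y. cyl (n y) y) ` Y" "Y \<subseteq> \<Union>\<F>"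
    using compactinD[OF Y, of "(\<lambda>y. cyl (n y) y) ` Y"] opencyl by auto
  then obtain C where C: "C \<subseteq> Y" "finite C" "\<F> = (\<lambda>y. cyl (n y) y) ` C"
    by (meson finite_subset_image)
  define N where "N = Max (n ` C)"
  have "\<phi> y 0 = \<phi> z 0" if yz: "y \<in> Y" "z \<in> Y" and ag: "agree N y z" for y z
  proof -
    obtain c where c: "c \<in> C" "agree (n c) c y"
      using \<F>(3) C(3) yz(1) by (auto simp: cyl_def)
    have "n c \<le> N" unfolding N_def using C c by auto
    then have "agree (n c) c z" using c(2) ag by (auto simp: agree_def)
    then show ?thesis using n[of c y] n[of c z] c C(1) yz by auto
  qed
  then show thesis by (rule that)
qed

text \<open>The negative powers need \<open>Y\<close> to be invariant under them too: the commutation is applied at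
  \<open>shift_by k y\<close> and then transported back.\<close>

lemma factor_map_shift_by:
  assumes Y: "\<And>k y. y \<in> Y \<Longrightarrow> shift_by k y \<in> Y"
    and comm: "\<forall>y\<in>Y. \<phi> (shift_map y) = shift_map (\<phi> y)"
    and y: "y \<in> Y"
  shows "\<phi> (shift_by k y) = shift_by k (\<phi> y)"
proof -
  have nat: "\<phi> (shift_by (int n) y) = shift_by (int n) (\<phi> y)" if "y \<in> Y" for n y
  proof (induction n)
    case (Suc n)
    have "\<phi> (shift_by (int (Suc n)) y) = \<phi> (shift_map (shift_by (int n) y))"
      by (simp add: shift_map_eq_shift_by)
    also have "\<dots> = shift_map (\<phi> (shift_by (int n) y))"
      using comm Y that by blast
    finally show ?case using Suc by (simp add: shift_map_eq_shift_by)
  qed simp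
  show ?thesis
  proof (cases "k \<ge> 0")
    case True
    then show ?thesis using nat[OF y, of "nat k"] by simp
  next
    case False
    have "\<phi> y = shift_by (- k) (\<phi> (shift_by k y))"
      using nat[OF Y[OF y], of "nat (- k)" k] False by simp
    then show ?thesis by simp
  qed
qed

text \<open>An occurrence of a word of length at most \<open>M\<close> is too short to leave the window
  \<open>[-M, M]\<close> on both sides, so it lies in a part of the glued point that comes from a single one
  of the two given points.\<close>

lemma finite_type_glue:
  assumes Y: "Y = {x \<in> topspace (full_shift B). \<forall>w\<in>F. \<not> occurs w x}"
    and len: "\<And>w. w \<in> F \<Longrightarrow> length w \<le> M"
    and y: "y \<in> Y" and z: "z \<in> Y" and ag: "agree M y z"
  shows "(\<lambda>i. if i < 0 then y i else z i) \<in> Y"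
proof -
  let ?g = "\<lambda>i. if i < 0 then y i else z i"
  have gy: "?g i = y i" if "i \<le> int M" for i
    using ag that by (auto simp: agree_def)
  have gz: "?g i = z i" if "i \<ge> - int M" for i
    using ag that by (auto simp: agree_def)
  have "\<not> occurs w ?g" if w: "w \<in> F" for w
  proof
    assume "occurs w ?g"
    then obtain i j where ij: "w = map ?g [i..j]" by (auto simp: occurs_def)
    then have "nat (j - i + 1) \<le> M" using len[OF w] by simp
    then have "j \<le> int M \<or> i \<ge> - int M" by linarith
    then have "w = map y [i..j] \<or> w = map z [i..j]"
    proof
      assume "j \<le> int M"
      then have "map ?g [i..j] = map y [i..j]" by (intro map_cong refl gy) auto
      then show ?thesis using ij by simp
    next
      assume "i \<ge> - int M"
      then have "map ?g [i..j] = map z [i..j]" by (intro map_cong refl gz) auto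
      then show ?thesis using ij by simp
    qed
    then show False using y z w by (auto simp: Y occurs_def)
  qed
  then show ?thesis using y z by (auto simp: Y topspace_full_shift)
qed

lemma join_rays_left [simp]: "join_rays y x (- int n - 1) = y n"
  by (simp add: join_rays_def)

lemma join_rays_right [simp]: "join_rays y x (int n) = x n"
  by (simp add: join_rays_def)

lemma join_rays_eqI:
  assumes "\<And>n. z (- int n - 1) = y n" and "\<And>n. z (int n) = x n"
  shows "join_rays y x = z"
proof
  fix i :: int
  show "join_rays y x i = z i"
    using assms(1)[of "nat (- i - 1)"] assms(2)[of "nat i"] by (auto simp: join_rays_def)
qed

lemma mem_past_of_ray: "y \<in> past_of_ray X x \<longleftrightarrow> join_rays y x \<in> X"
proof -
  have "y \<in> left_rays X" if "join_rays y x \<in> X"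
    using that unfolding left_rays_def
    by (intro CollectI exI[of _ "join_rays y x"]) auto
  then show ?thesis by (auto simp: past_of_ray_def)
qed

text \<open>Let \<open>\<phi> : Y \<rightarrow> X\<close> be a factor map from a shift of finite type, and \<open>M\<close> a bound for both its local
  rule and the forbidden words. The past of \<open>x\<^sup>+\<close> depends only on the set of words on \<open>[-M, M]\<close>
  seen in those points of \<open>Y\<close> whose image continues as \<open>x\<^sup>+\<close>: two points that share such a word can
  be glued at the origin, and the local rule carries the glued point to the glued image. There
  are finitely many sets of words of length \<open>2 M + 1\<close>.\<close>

lemma finite_Krieger_vertices:
  assumes "sofic A X"
  shows "finite (Krieger_vertices X)"
proof -
  from assms obtain B :: "nat set" and Y \<phi> where ft: "finite_type B Y"
    and cont: "continuous_map (subtopology (full_shift B) Y) (full_shift A) \<phi>"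
    and comm: "\<forall>y\<in>Y. \<phi> (shift_map y) = shift_map (\<phi> y)" and im: "\<phi> ` Y = X"
    by (auto simp: sofic_def)
  from ft obtain F where B: "finite B" and F: "finite F"
    and Y: "Y = {x \<in> topspace (full_shift B). \<forall>w\<in>F. \<not> occurs w x}"
    by (auto simp: finite_type_def)
  have "compactin (full_shift B) Y"
    by (intro closedin_compact_space compact_space_full_shift closedin_finite_type B ft)
  from continuous_map_depends_on_window[OF this cont] obtain N
    where N: "\<And>y z. y \<in> Y \<Longrightarrow> z \<in> Y \<Longrightarrow> agree N y z \<Longrightarrow> \<phi> y 0 = \<phi> z 0" by blast
  note sh = finite_type_shift_by[OF ft]
  have local: "\<phi> y k = \<phi> z k"
    if "y \<in> Y" "z \<in> Y" "\<And>i. \<bar>i - k\<bar> \<le> int N \<Longrightarrow> z i = y i" for y z k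
  proof -
    have "\<phi> (shift_by k y) 0 = \<phi> (shift_by k z) 0"
      using that by (intro N sh) (auto simp: agree_def shift_by_def)
    then show ?thesis
      using factor_map_shift_by[OF sh comm, of y k] factor_map_shift_by[OF sh comm, of z k] that
      by (simp add: shift_by_def)
  qed
  define M where "M = max N (Max (length ` F))"
  have len: "length w \<le> M" if "w \<in> F" for w
    unfolding M_def using F that by (simp add: le_max_iff_disj)
  define window where "window y = map y [- int M..int M]" for y :: "int \<Rightarrow> nat"
  have window_eq: "window y = window z \<longleftrightarrow> agree M y z" for y z
    by (auto simp: window_def agree_def abs_le_iff)
  define windows where
    "windows x = {window y |y. y \<in> Y \<and> (\<forall>n. \<phi> y (int n) = x n)}" for x
  \<comment> \<open>\<open>g\<close> recovers the past of a ray from its set of windows.\<close>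
  define g where
    "g W = {\<lambda>n. \<phi> z (- int n - 1) |z. z \<in> Y \<and> window z \<in> W}" for W
  have past: "past_of_ray X x = g (windows x)" for x
  proof (intro set_eqI iffI)
    fix l assume "l \<in> past_of_ray X x"
    then obtain y where y: "y \<in> Y" "\<phi> y = join_rays l x"
      using im by (auto simp: mem_past_of_ray)
    then have "window y \<in> windows x" by (auto simp: windows_def)
    moreover have "l = (\<lambda>n. \<phi> y (- int n - 1))" using y by simp
    ultimately show "l \<in> g (windows x)" unfolding g_def using y(1) by blast
  next
    fix l assume "l \<in> g (windows x)"
    then obtain y z where y: "y \<in> Y" "l = (\<lambda>n. \<phi> y (- int n - 1))"
      and z: "z \<in> Y" "\<And>n. \<phi> z (int n) = x n" and "window y = window z"
      by (auto simp: g_def windows_def)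
    then have ag: "agree M y z" by (simp add: window_eq)
    define h where "h i = (if i < 0 then y i else z i)" for i
    have h: "h \<in> Y"
      unfolding h_def using finite_type_glue[OF Y len y(1) z(1) ag] .
    have NM: "N \<le> M" by (simp add: M_def)
    have "join_rays l x = \<phi> h"
    proof (rule join_rays_eqI)
      fix n
      have "\<phi> h (- int n - 1) = \<phi> y (- int n - 1)"
        using h y(1) ag NM by (intro local) (auto simp: h_def agree_def)
      then show "\<phi> h (- int n - 1) = l n" by (simp add: y)
      have "\<phi> h (int n) = \<phi> z (int n)"
        using h z(1) ag NM by (intro local) (auto simp: h_def agree_def)
      then show "\<phi> h (int n) = x n" by (simp add: z)
    qed
    then show "l \<in> past_of_ray X x" using h im by (auto simp: mem_past_of_ray)
  qed
  let ?L = "{w. set w \<subseteq> B \<and> length w = length [- int M..int M]}"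
  have "window y \<in> ?L" if "y \<in> Y" for y
    using that by (auto simp: window_def Y topspace_full_shift)
  then have "windows x \<subseteq> ?L" for x unfolding windows_def by blast
  then have "Krieger_vertices X \<subseteq> g ` Pow ?L"
    unfolding Krieger_vertices_def using past by blast
  moreover have "finite (Pow ?L)" using B by (simp add: finite_lists_length_eq)
  ultimately show ?thesis by (meson finite_imageI finite_subset)
qed

section \<open>Stripping symbols off left rays\<close>

text \<open>The quotient $P a^{-1}$ of the introduction. For a vertex \<open>P\<close> of either cover it is the source
  of the only edge labelled \<open>a\<close> that can enter \<open>P\<close>.\<close>

definition strip :: "'a \<Rightarrow> 'a left_ray set \<Rightarrow> 'a left_ray set" where
  "strip a P = {y. append_word y [a] \<in> P}"

lemma strip_Union: "strip a (\<Union>V) = (\<Union>P\<in>V. strip a P)"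
  by (auto simp: strip_def)

fun strips :: "'a left_ray \<Rightarrow> 'a left_ray set \<Rightarrow> nat \<Rightarrow> 'a left_ray set" where
  "strips y P 0 = P"
| "strips y P (Suc n) = strip (y n) (strips y P n)"

lemma mem_strips_iff:
  "u \<in> strips y P n \<longleftrightarrow> (\<lambda>i. if i < n then y i else u (i - n)) \<in> P"
proof (induction n arbitrary: u)
  case (Suc n)
  have "(\<lambda>i. if i < n then y i else append_word u [y n] (i - n)) =
      (\<lambda>i. if i < Suc n then y i else u (i - Suc n))"
    by (auto simp: fun_eq_iff append_word_def less_Suc_eq)
  then show ?case using Suc[of "append_word u [y n]"] by (simp add: strip_def)
qed simp

lemma append_word_Cons: "append_word y (a # w) = append_word (append_word y [a]) w"
  by (rule ext) (auto simp: append_word_def nth_append not_less le_Suc_eq)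

lemma past_of_word_Cons_mem:
  "append_word y (a # w) \<in> left_rays X \<longleftrightarrow> append_word (append_word y [a]) w \<in> left_rays X"
  by (subst append_word_Cons) simp

lemma join_rays_cons_ray:
  "join_rays (append_word y [a]) x = shift_by 1 (join_rays y (cons_ray a x))"
proof (rule join_rays_eqI)
  fix n
  show "shift_by 1 (join_rays y (cons_ray a x)) (- int n - 1) = append_word y [a] n"
    by (cases n) (auto simp: shift_by_def join_rays_def cons_ray_def append_word_def)
  show "shift_by 1 (join_rays y (cons_ray a x)) (int n) = x n"
    by (auto simp: shift_by_def join_rays_def cons_ray_def nat_add_distrib)
qed

section \<open>Labelled graphs through their two projections\<close>

lemma left_resolving_iff:
  "left_resolving \<E> \<longleftrightarrow> (\<forall>e\<in>arcs (fst \<E>). \<forall>f\<in>arcs (fst \<E>).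
     head (fst \<E>) e = head (fst \<E>) f \<and> snd \<E> e = snd \<E> f \<longrightarrow> e = f)"
  by (cases \<E>) simp

lemma pasts_eq:
  "pasts \<E> v = {\<lambda>n. snd \<E> (p n) |p. (\<forall>n. p n \<in> arcs (fst \<E>)) \<and>
     head (fst \<E>) (p 0) = v \<and> (\<forall>n. head (fst \<E>) (p (Suc n)) = tail (fst \<E>) (p n))}"
  by (cases \<E>) simp

lemma predecessor_separated_iff:
  "predecessor_separated \<E> \<longleftrightarrow> inj_on (pasts \<E>) (verts (fst \<E>))"
  by (cases \<E>) simp

lemma preimage_eq:
  "preimage \<E> a V =
     {tail (fst \<E>) e |e. e \<in> arcs (fst \<E>) \<and> snd \<E> e = a \<and> head (fst \<E>) e \<in> V}"
  by (cases \<E>) simp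

lemma labelled_graph_isomorphic_graph_of_triples:
  fixes c :: "'v \<Rightarrow> 'w" and T :: "('v \<times> 'a \<times> 'v) set"
  assumes inj: "inj_on c V" and T: "\<And>u a v. (u, a, v) \<in> T \<Longrightarrow> u \<in> V \<and> v \<in> V"
  shows "labelled_graph_isomorphic (graph_of_triples V T)
    (graph_of_triples (c ` V) ((\<lambda>(u, a, v). (c u, a, c v)) ` T))"
proof -
  define f :: "('v, 'v \<times> 'a \<times> 'v, 'w, 'w \<times> 'a \<times> 'w) digraph_isomorphism"
    where "f = \<lparr>iso_verts = c, iso_arcs = (\<lambda>(u, a, v). (c u, a, c v)),
      iso_head = (\<lambda>(u, a, v). v), iso_tail = (\<lambda>(u, a, v). u)\<rparr>"
  let ?G = "\<lparr>verts = V, arcs = T, tail = (\<lambda>(u, a, v). u), head = (\<lambda>(u, a, v). v)\<rparr>"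
  have "inj_on (\<lambda>(u, a, v). (c u, a, c v)) T"
  proof (rule inj_onI)
    fix e e' assume "e \<in> T" "e' \<in> T"
      "(\<lambda>(u, a, v). (c u, a, c v)) e = (\<lambda>(u, a, v). (c u, a, c v)) e'"
    then show "e = e'" by (cases e; cases e') (auto dest!: T dest: inj_onD[OF inj])
  qed
  moreover have "wf_digraph ?G"
    by unfold_locales (auto dest: T)
  ultimately have "pre_digraph.digraph_isomorphism ?G f"
    using inj unfolding pre_digraph.digraph_isomorphism_def by (auto simp: f_def)
  then show ?thesis
    unfolding graph_of_triples_def labelled_graph_isomorphic.simps
    by (intro exI[of _ f]) (simp add: f_def app_iso_def split_beta)
qed

section \<open>Pasts of rays and pasts of words\<close>

locale shift =
  fixes A :: "'a set" and X :: "(int \<Rightarrow> 'a) set"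
  assumes shift_space: "shift_space A X"
begin

lemma symbol_mem: "x \<in> X \<Longrightarrow> x i \<in> A"
  using shift_space closedin_subset[of "full_shift A" X]
  by (auto simp: shift_space_def topspace_full_shift)

text \<open>The sequential form in which closedness of \<open>X\<close> is used.\<close>

lemma mem_by_approximation:
  assumes "\<And>n. \<exists>z\<in>X. agree n x z"
  shows "x \<in> X"
proof (rule ccontr)
  assume "x \<notin> X"
  have "x i \<in> A" for i
  proof -
    obtain z where "z \<in> X" "agree (nat \<bar>i\<bar>) x z" using assms by blast
    then show ?thesis using symbol_mem[of z i] by (simp add: agree_def)
  qed
  then have "x \<in> topspace (full_shift A) - X"
    using \<open>x \<notin> X\<close> by (simp add: topspace_full_shift)
  moreover have "openin (full_shift A) (topspace (full_shift A) - X)"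
    using shift_space by (simp add: shift_space_def closedin_def)
  ultimately obtain n where n: "\<forall>z\<in>topspace (full_shift A). agree n x z \<longrightarrow> z \<notin> X"
    unfolding openin_full_shift_iff by blast
  obtain z where z: "z \<in> X" "agree n x z" using assms by blast
  then have "z \<in> topspace (full_shift A)" by (simp add: topspace_full_shift symbol_mem)
  then show False using n z by blast
qed

lemma shift_by_mem_iff [simp]: "shift_by k x \<in> X \<longleftrightarrow> x \<in> X"
proof -
  have one: "shift_by 1 x \<in> X \<longleftrightarrow> x \<in> X" for x
  proof
    assume "shift_by 1 x \<in> X"
    then obtain z where "z \<in> X" "shift_by 1 x = shift_by 1 z"
      using shift_space by (auto simp: shift_space_def shift_map_eq_shift_by)
    then have "shift_by (-1) (shift_by 1 x) = shift_by (-1) (shift_by 1 z)" by simp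
    then show "x \<in> X" using \<open>z \<in> X\<close> by simp
  next
    assume "x \<in> X"
    then show "shift_by 1 x \<in> X"
      using shift_space by (auto simp: shift_space_def shift_map_eq_shift_by)
  qed
  have nat: "shift_by (int n) x \<in> X \<longleftrightarrow> x \<in> X" for n x
  proof (induction n)
    case (Suc n)
    have "shift_by (int (Suc n)) x = shift_by 1 (shift_by (int n) x)" by simp
    then show ?case using Suc one by metis
  qed simp
  show ?thesis
  proof (cases "k \<ge> 0")
    case True
    then show ?thesis using nat[of "nat k"] by simp
  next
    case False
    then show ?thesis using nat[of "nat (- k)" "shift_by k x"] by simp
  qed
qed

lemma past_of_ray_cons: "past_of_ray X (cons_ray a x) = strip a (past_of_ray X x)"
  by (auto simp: mem_past_of_ray strip_def join_rays_cons_ray)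

lemma right_rays_iff: "x \<in> right_rays X \<longleftrightarrow> past_of_ray X x \<noteq> {}"
proof
  assume "x \<in> right_rays X"
  then obtain z where z: "z \<in> X" "x = (\<lambda>n. z (int n))" by (auto simp: right_rays_def)
  then have "join_rays (\<lambda>n. z (- int n - 1)) x = z" by (intro join_rays_eqI) auto
  then have "(\<lambda>n. z (- int n - 1)) \<in> past_of_ray X x" using z by (simp add: mem_past_of_ray)
  then show "past_of_ray X x \<noteq> {}" by blast
next
  assume "past_of_ray X x \<noteq> {}"
  then obtain y where "join_rays y x \<in> X" by (auto simp: mem_past_of_ray)
  then show "x \<in> right_rays X"
    unfolding right_rays_def by (intro CollectI exI[of _ "join_rays y x"]) auto
qed

text \<open>Shifting by \<open>length w\<close> moves the origin from the right end of \<open>w\<close> to its left end; the rest of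
  a point that contains \<open>y w\<close> then becomes a right ray beginning with \<open>w\<close>.\<close>

lemma append_word_mem_left_rays_iff:
  "append_word y w \<in> left_rays X \<longleftrightarrow> (\<exists>x. join_rays y x \<in> X \<and> map x [0..<length w] = w)"
proof
  assume "append_word y w \<in> left_rays X"
  then obtain z where z: "z \<in> X" "append_word y w = (\<lambda>n. z (- int n - 1))"
    by (auto simp: left_rays_def)
  define x where "x = (\<lambda>n. z (int n - int (length w)))"
  have zn: "z (- int n - 1) = append_word y w n" for n using z by simp
  have "join_rays y x = shift_by (- int (length w)) z"
  proof (rule join_rays_eqI)
    fix n
    show "shift_by (- int (length w)) z (- int n - 1) = y n"
      using zn[of "n + length w"] by (simp add: shift_by_def append_word_def algebra_simps)
  qed (simp add: x_def shift_by_def)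
  moreover have "map x [0..<length w] = w"
  proof (rule nth_equalityI)
    fix i assume "i < length (map x [0..<length w])"
    then have i: "i < length w" by simp
    have "x i = z (- int (length w - 1 - i) - 1)"
      using i by (simp add: x_def of_nat_diff algebra_simps)
    also have "\<dots> = append_word y w (length w - 1 - i)" by (rule zn)
    also have "\<dots> = rev w ! (length w - 1 - i)" unfolding append_word_def using i by (intro if_P) linarith
    also have "\<dots> = w ! i" using i by (subst rev_nth) auto
    finally show "map x [0..<length w] ! i = w ! i" using i by simp
  qed simp
  ultimately show "\<exists>x. join_rays y x \<in> X \<and> map x [0..<length w] = w"
    using z by (metis shift_by_mem_iff)
next
  assume "\<exists>x. join_rays y x \<in> X \<and> map x [0..<length w] = w"
  then obtain x where x: "join_rays y x \<in> X" "map x [0..<length w] = w" by blast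
  have wi: "w ! i = x i" if "i < length w" for i
    using that by (subst x(2)[symmetric]) simp
  let ?z = "shift_by (int (length w)) (join_rays y x)"
  have "append_word y w = (\<lambda>n. ?z (- int n - 1))"
  proof
    fix n
    show "append_word y w n = ?z (- int n - 1)"
    proof (cases "n < length w")
      case True
      then have "- int n - 1 + int (length w) = int (length w - Suc n)" by simp
      then show ?thesis
        using True wi[of "length w - Suc n"]
        by (simp only: shift_by_def join_rays_right) (simp add: append_word_def rev_nth)
    next
      case False
      then have "- int n - 1 + int (length w) = - int (n - length w) - 1" by simp
      then show ?thesis
        using False by (simp only: shift_by_def join_rays_left) (simp add: append_word_def)
    qed
  qed
  then show "append_word y w \<in> left_rays X"
    unfolding left_rays_def using x(1) by (intro CollectI exI[of _ ?z]) auto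
qed

lemma mem_past_of_word:
  "y \<in> past_of_word X w \<longleftrightarrow> append_word y w \<in> left_rays X"
proof -
  have "y \<in> left_rays X" if "append_word y w \<in> left_rays X"
    using that unfolding append_word_mem_left_rays_iff
    by (metis (no_types, lifting) mem_past_of_ray past_of_ray_def mem_Collect_eq)
  then show ?thesis by (auto simp: past_of_word_def)
qed

lemma past_of_word_Cons: "past_of_word X (a # w) = strip a (past_of_word X w)"
  by (auto simp: mem_past_of_word strip_def past_of_word_Cons_mem)

lemma past_of_word_eq_Union:
  "past_of_word X w = \<Union>{past_of_ray X x |x. x \<in> right_rays X \<and> map x [0..<length w] = w}"
proof (intro set_eqI)
  fix y
  have "y \<in> past_of_word X w \<longleftrightarrow> (\<exists>x. y \<in> past_of_ray X x \<and> map x [0..<length w] = w)"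
    by (simp add: mem_past_of_word append_word_mem_left_rays_iff mem_past_of_ray)
  then show "y \<in> past_of_word X w \<longleftrightarrow>
      y \<in> \<Union>{past_of_ray X x |x. x \<in> right_rays X \<and> map x [0..<length w] = w}"
    unfolding right_rays_iff by blast
qed

lemma past_of_word_Union_Krieger: "\<exists>V\<subseteq>Krieger_vertices X. past_of_word X w = \<Union>V"
proof (intro exI conjI)
  show "past_of_word X w = \<Union>{past_of_ray X x |x. x \<in> right_rays X \<and> map x [0..<length w] = w}"
    by (rule past_of_word_eq_Union)
qed (auto simp: Krieger_vertices_def)

lemma words_iff: "w \<in> words X \<longleftrightarrow> w \<noteq> [] \<and> past_of_word X w \<noteq> {}"
proof (cases "w = []")
  case False
  show ?thesis
  proof
    assume "w \<in> words X"
    then obtain z i j where z: "z \<in> X" "w = map z [i..j]"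
      by (auto simp: words_def occurs_def)
    define x where "x = (\<lambda>n. shift_by i z (int n))"
    have "x \<in> right_rays X"
      unfolding right_rays_def x_def using z by (intro CollectI exI[of _ "shift_by i z"]) auto
    then obtain y where "y \<in> past_of_ray X x" by (auto simp: right_rays_iff)
    moreover have "map x [0..<length w] = w"
      unfolding z(2) by (rule nth_equalityI) (auto simp: x_def shift_by_def algebra_simps)
    ultimately show "w \<noteq> [] \<and> past_of_word X w \<noteq> {}"
      using False \<open>x \<in> right_rays X\<close> by (subst past_of_word_eq_Union) auto
  next
    assume "w \<noteq> [] \<and> past_of_word X w \<noteq> {}"
    then obtain y x where x: "join_rays y x \<in> X" "map x [0..<length w] = w"
      by (auto simp: mem_past_of_word append_word_mem_left_rays_iff)
    have "w = map (join_rays y x) [0..int (length w) - 1]"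
    proof (rule nth_equalityI)
      fix i assume i: "i < length w"
      then have "map (join_rays y x) [0..int (length w) - 1] ! i = x i" by simp
      also have "\<dots> = w ! i" using arg_cong[OF x(2), of "\<lambda>l. l ! i"] i by simp
      finally show "w ! i = map (join_rays y x) [0..int (length w) - 1] ! i" ..
    qed simp
    then show "w \<in> words X" using False x(1) unfolding words_def occurs_def by blast
  qed
qed (simp add: words_def)

text \<open>A point all of whose finite right truncations can be continued in \<open>X\<close> lies in \<open>X\<close>, as \<open>X\<close> is
  closed.\<close>

lemma past_of_ray_eq_Inter:
  "past_of_ray X x = (\<Inter>n. past_of_word X (map x [0..<Suc n]))"
proof (intro set_eqI iffI)
  fix y assume "y \<in> past_of_ray X x"
  then show "y \<in> (\<Inter>n. past_of_word X (map x [0..<Suc n]))"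
    by (auto simp: mem_past_of_ray mem_past_of_word append_word_mem_left_rays_iff
        simp del: upt_Suc)
next
  fix y assume y: "y \<in> (\<Inter>n. past_of_word X (map x [0..<Suc n]))"
  have "join_rays y x \<in> X"
  proof (rule mem_by_approximation)
    fix n
    from y have "y \<in> past_of_word X (map x [0..<Suc n])" by blast
    then obtain x' where x': "join_rays y x' \<in> X" "map x' [0..<Suc n] = map x [0..<Suc n]"
      by (auto simp: mem_past_of_word append_word_mem_left_rays_iff simp del: upt_Suc)
    have "x' i = x i" if "i \<le> n" for i
      using x'(2) that by (simp del: upt_Suc)
    then have "agree n (join_rays y x) (join_rays y x')"
      by (auto simp: agree_def join_rays_def)
    then show "\<exists>z\<in>X. agree n (join_rays y x) z" using x'(1) by blast
  qed
  then show "y \<in> past_of_ray X x" by (simp add: mem_past_of_ray)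
qed

text \<open>The rays in \<open>P\<close> that end in ever longer suffixes of \<open>y\<close> converge to \<open>y\<close>, and \<open>X\<close> is closed.
  The hypothesis on \<open>strips\<close> is what a left-infinite path labelled \<open>y\<close> provides.\<close>

lemma past_of_ray_closed:
  assumes P: "P \<in> Krieger_vertices X" and ne: "\<And>n. strips y P n \<noteq> {}"
  shows "y \<in> P"
proof -
  obtain x where x: "P = past_of_ray X x" using P by (auto simp: Krieger_vertices_def)
  have "join_rays y x \<in> X"
  proof (rule mem_by_approximation)
    fix n
    obtain u where "(\<lambda>i. if i < n then y i else u (i - n)) \<in> P"
      using ne[of n] by (auto simp: mem_strips_iff)
    then have "join_rays (\<lambda>i. if i < n then y i else u (i - n)) x \<in> X"
      by (simp add: x mem_past_of_ray)
    moreover have "agree n (join_rays y x) (join_rays (\<lambda>i. if i < n then y i else u (i - n)) x)"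
      by (auto simp: agree_def join_rays_def)
    ultimately show "\<exists>z\<in>X. agree n (join_rays y x) z" by blast
  qed
  then show ?thesis by (simp add: x mem_past_of_ray)
qed

text \<open>The pasts of the prefixes of \<open>x\<close> decrease to the past of \<open>x\<close>. As unions of Krieger vertices
  they take only finitely many values, so the intersection is attained.\<close>

lemma past_of_ray_is_past_of_word:
  assumes fin: "finite (Krieger_vertices X)" and x: "x \<in> right_rays X"
  shows "past_of_ray X x \<in> past_of_word X ` words X"
proof -
  define p where "p n = past_of_word X (map x [0..<Suc n])" for n
  have "p n \<in> Union ` Pow (Krieger_vertices X)" for n
    using past_of_word_Union_Krieger[of "map x [0..<Suc n]"] unfolding p_def by auto
  then have "range p \<subseteq> Union ` Pow (Krieger_vertices X)" by blast
  then have "finite (range p)"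
    by (rule finite_subset) (simp add: fin)
  moreover have "decseq p"
    unfolding decseq_def
  proof (intro allI impI subsetI)
    fix m n y assume "m \<le> n" "y \<in> p n"
    then obtain x' where x': "join_rays y x' \<in> X" "map x' [0..<Suc n] = map x [0..<Suc n]"
      by (auto simp: p_def mem_past_of_word append_word_mem_left_rays_iff simp del: upt_Suc)
    have "map x' [0..<Suc m] = map x [0..<Suc m]"
      using x'(2) \<open>m \<le> n\<close> by (auto simp del: upt_Suc)
    then show "y \<in> p m"
      using x' by (auto simp: p_def mem_past_of_word append_word_mem_left_rays_iff simp del: upt_Suc)
  qed
  moreover have "\<exists>n. p n = \<Inter>(range p)"
  proof -
    have "\<exists>Q\<in>range p. \<forall>Q'\<in>range p. Q' \<subseteq> Q \<longrightarrow> Q = Q'"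
      using \<open>finite (range p)\<close> by (rule finite_has_minimal) simp
    then obtain n where n: "\<And>m. p m \<subseteq> p n \<Longrightarrow> p m = p n"
      by auto
    have "p n \<subseteq> p m" for m
    proof -
      have "p (max m n) = p n" using \<open>decseq p\<close> by (intro n) (simp add: decseq_def)
      then show ?thesis using \<open>decseq p\<close> by (metis decseq_def max.cobounded1)
    qed
    then show ?thesis by blast
  qed
  ultimately obtain n where n: "past_of_ray X x = past_of_word X (map x [0..<Suc n])"
    unfolding past_of_ray_eq_Inter p_def by metis
  then have "map x [0..<Suc n] \<in> words X"
    using x unfolding words_iff right_rays_iff by simp
  then show ?thesis using n by blast
qed

section \<open>Predecessor-closed parts of the Krieger cover\<close>

text \<open>Whether \<open>a x\<^sup>+\<close> occurs, and its past, depend only on the past \<open>Q\<close> of \<open>x\<^sup>+\<close> and not on the ray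
  representing \<open>Q\<close>.\<close>

lemma Krieger_arcs:
  "arcs (fst (left_Krieger_cover X)) =
     {(strip a Q, a, Q) |a Q. Q \<in> Krieger_vertices X \<and> strip a Q \<noteq> {}}"
proof -
  have "{(past_of_ray X (cons_ray a x), a, past_of_ray X x) |a x.
        x \<in> right_rays X \<and> cons_ray a x \<in> right_rays X} =
      {(strip a Q, a, Q) |a Q. Q \<in> past_of_ray X ` right_rays X \<and> strip a Q \<noteq> {}}"
    unfolding right_rays_iff[of "cons_ray _ _"] past_of_ray_cons by blast
  then show ?thesis
    by (simp add: left_Krieger_cover_def graph_of_triples_def Krieger_vertices_def)
qed

lemma Krieger_graph:
  "verts (fst (left_Krieger_cover X)) = Krieger_vertices X"
  "tail (fst (left_Krieger_cover X)) = (\<lambda>(u, a, v). u)"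
  "head (fst (left_Krieger_cover X)) = (\<lambda>(u, a, v). v)"
  "snd (left_Krieger_cover X) = (\<lambda>(u, a, v). a)"
  by (auto simp: left_Krieger_cover_def graph_of_triples_def)

lemma Krieger_vertex_nonempty: "P \<in> Krieger_vertices X \<Longrightarrow> P \<noteq> {}"
  by (auto simp: Krieger_vertices_def right_rays_iff)

lemma strip_Krieger_vertex:
  assumes "P \<in> Krieger_vertices X" "strip a P \<noteq> {}"
  shows "strip a P \<in> Krieger_vertices X" and "a \<in> A"
proof -
  obtain x where x: "P = past_of_ray X x" using assms by (auto simp: Krieger_vertices_def)
  then show "strip a P \<in> Krieger_vertices X"
    using assms by (auto simp: past_of_ray_cons[symmetric] right_rays_iff Krieger_vertices_def)
  obtain y where "join_rays (append_word y [a]) x \<in> X"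
    using assms by (auto simp: x strip_def mem_past_of_ray)
  from symbol_mem[OF this, of "-1"] show "a \<in> A"
    by (simp add: join_rays_def append_word_def)
qed

definition Krieger_part where
  "Krieger_part H = (fst (left_Krieger_cover X) \<restriction> H, snd (left_Krieger_cover X))"

lemma wf_Krieger: "wf_digraph (fst (left_Krieger_cover X))"
  by unfold_locales (auto simp: Krieger_arcs Krieger_graph intro: strip_Krieger_vertex)

lemma Krieger_part_all: "Krieger_part (Krieger_vertices X) = left_Krieger_cover X"
proof -
  have "fst (left_Krieger_cover X) \<restriction> Krieger_vertices X = fst (left_Krieger_cover X)"
    by (rule pre_digraph.equality)
      (auto simp: Krieger_graph Krieger_arcs intro: strip_Krieger_vertex)
  then show ?thesis by (simp add: Krieger_part_def)
qed

end

text \<open>The common frame for both covers: subgraphs of the left Krieger cover that contain, with a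
  vertex, all of its predecessors, so that no left-infinite path is lost by restriction.\<close>

locale Krieger_hereditary = shift A X for A :: "'a set" and X +
  fixes H :: "'a left_ray set set"
  assumes finite_Krieger: "finite (Krieger_vertices X)"
    and subset: "H \<subseteq> Krieger_vertices X"
    and strip_closed: "Q \<in> H \<Longrightarrow> strip a Q \<noteq> {} \<Longrightarrow> strip a Q \<in> H"
begin

abbreviation "\<K> \<equiv> fst (Krieger_part H)"
abbreviation "label \<equiv> snd (Krieger_part H)"

lemma verts_part: "verts \<K> = H"
  and tail_part: "tail \<K> = (\<lambda>(u, a, v). u)"
  and head_part: "head \<K> = (\<lambda>(u, a, v). v)"
  and label_part: "label = (\<lambda>(u, a, v). a)"
  by (simp_all add: Krieger_part_def Krieger_graph)

lemma arcs_part: "arcs \<K> = {(strip a Q, a, Q) |a Q. Q \<in> H \<and> strip a Q \<noteq> {}}"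
proof -
  have "arcs \<K> = {e \<in> {(strip a Q, a, Q) |a Q. Q \<in> Krieger_vertices X \<and> strip a Q \<noteq> {}}.
      (\<lambda>(u, a, v). u) e \<in> H \<and> (\<lambda>(u, a, v). v) e \<in> H}"
    by (simp add: Krieger_part_def Krieger_graph Krieger_arcs)
  also have "\<dots> = {(strip a Q, a, Q) |a Q. Q \<in> H \<and> strip a Q \<noteq> {}}"
    using subset strip_closed by fast
  finally show ?thesis .
qed

lemma finite_part: "fin_digraph \<K>"
proof
  have H: "finite H" using finite_Krieger subset by (rule finite_subset[rotated])
  then show "finite (verts \<K>)" by (simp add: verts_part)
  have "arcs \<K> \<subseteq> H \<times> A \<times> H"
    unfolding arcs_part using subset strip_closed strip_Krieger_vertex(2) by blast
  then show "finite (arcs \<K>)"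
    using H shift_space by (auto simp: shift_space_def intro: finite_subset)
next
  fix e assume "e \<in> arcs \<K>"
  then obtain a Q where "e = (strip a Q, a, Q)" "Q \<in> H" "strip a Q \<noteq> {}"
    unfolding arcs_part by blast
  then show "tail \<K> e \<in> verts \<K>" "head \<K> e \<in> verts \<K>"
    by (simp_all add: verts_part tail_part head_part strip_closed)
qed

lemma left_resolving_part: "left_resolving (Krieger_part H)"
  unfolding left_resolving_iff arcs_part head_part label_part by auto

text \<open>A path labelled \<open>y\<close> into \<open>P\<close> must run through the vertices \<open>strips y P n\<close>. It exists iff they
  are all nonempty, that is, iff each suffix of \<open>y\<close> ends a ray in \<open>P\<close>, and by closedness iff
  \<open>y \<in> P\<close>. Hence a vertex is determined by its left-infinite label sequences.\<close>

lemma pasts_part: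
  assumes P: "P \<in> H"
  shows "pasts (Krieger_part H) P = P"
proof (intro set_eqI iffI)
  fix y assume "y \<in> pasts (Krieger_part H) P"
  then obtain p where y: "y = (\<lambda>n. label (p n))" and arcs: "\<And>n. p n \<in> arcs \<K>"
    and hd: "head \<K> (p 0) = P" and step: "\<And>n. head \<K> (p (Suc n)) = tail \<K> (p n)"
    unfolding pasts_eq by blast
  have tl: "tail \<K> (p n) = strip (y n) (head \<K> (p n))" "tail \<K> (p n) \<noteq> {}" for n
    using arcs[of n] unfolding y arcs_part tail_part head_part label_part by auto
  have "head \<K> (p n) = strips y P n" for n
    by (induction n) (simp_all add: hd step tl)
  then have "strips y P (Suc n) \<noteq> {}" for n using tl[of n] by simp
  then have "strips y P n \<noteq> {}" for n
    using Krieger_vertex_nonempty P subset by (cases n) auto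
  then show "y \<in> P" using past_of_ray_closed P subset by blast
next
  fix y assume y: "y \<in> P"
  have ne: "strips y P n \<noteq> {}" for n
  proof -
    have "(\<lambda>i. if i < n then y i else y (i - n + n)) = y" by (auto simp: fun_eq_iff)
    then have "(\<lambda>i. y (i + n)) \<in> strips y P n" using y by (simp add: mem_strips_iff)
    then show ?thesis by blast
  qed
  have H: "strips y P n \<in> H" for n
  proof (induction n)
    case (Suc n)
    then show ?case using strip_closed ne[of "Suc n"] by simp
  qed (simp add: P)
  define p where "p n = (strips y P (Suc n), y n, strips y P n)" for n
  have "p n \<in> arcs \<K>" for n
    using H[of n] ne[of "Suc n"] by (auto simp: p_def arcs_part)
  then show "y \<in> pasts (Krieger_part H) P"
    unfolding pasts_eq
    by (intro CollectI exI[of _ p]) (simp add: p_def label_part head_part tail_part)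
qed

lemma predecessor_separated_part: "predecessor_separated (Krieger_part H)"
  unfolding predecessor_separated_iff verts_part by (simp add: inj_on_def pasts_part)

lemma preimage_part:
  assumes "V \<subseteq> H"
  shows "preimage (Krieger_part H) a V = {strip a Q |Q. Q \<in> V \<and> strip a Q \<noteq> {}}"
proof (intro set_eqI iffI)
  fix P assume "P \<in> preimage (Krieger_part H) a V"
  then obtain e where "e \<in> arcs \<K>" "label e = a" "head \<K> e \<in> V" "P = tail \<K> e"
    unfolding preimage_eq by blast
  then show "P \<in> {strip a Q |Q. Q \<in> V \<and> strip a Q \<noteq> {}}"
    unfolding arcs_part tail_part head_part label_part by auto
next
  fix P assume "P \<in> {strip a Q |Q. Q \<in> V \<and> strip a Q \<noteq> {}}"
  then obtain Q where Q: "Q \<in> V" "strip a Q \<noteq> {}" "P = strip a Q" by blast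
  then have "(P, a, Q) \<in> arcs \<K>" using assms by (auto simp: arcs_part)
  then show "P \<in> preimage (Krieger_part H) a V"
    unfolding preimage_eq using Q
    by (intro CollectI exI[of _ "(P, a, Q)"]) (simp add: tail_part head_part label_part)
qed

lemma Union_preimage_part:
  assumes "V \<subseteq> H"
  shows "\<Union>(preimage (Krieger_part H) a V) = strip a (\<Union>V)"
  unfolding preimage_part[OF assms] strip_Union by blast

lemma preimage_part_empty_iff:
  assumes "V \<subseteq> H"
  shows "preimage (Krieger_part H) a V = {} \<longleftrightarrow> strip a (\<Union>V) = {}"
  unfolding preimage_part[OF assms] strip_Union by blast

text \<open>The hypothesis \<open>gen\<close> says that each Krieger vertex is the union of the members of \<open>H\<close> below it;
  $P_\infty(w)$, a union of Krieger vertices, is then a union of members of \<open>H\<close> too. Since unions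
  commute with preimages, identifying sets of vertices with equal union is compatible with the
  edges, and the class of \<open>V\<close> can be renamed to \<open>\<Union>V\<close>.\<close>

lemma foundation_part:
  assumes gen: "\<And>P y. P \<in> Krieger_vertices X \<Longrightarrow> y \<in> P \<Longrightarrow> \<exists>Q\<in>H. y \<in> Q \<and> Q \<subseteq> P"
  shows "foundation (Krieger_part H) (past_set_cover X)"
proof -
  let ?W = "past_of_word X ` words X"
  define S where "S = {V. V \<subseteq> H \<and> V \<noteq> {} \<and> \<Union>V \<in> ?W}"
  define R where "R = {(U, V). U \<in> S \<and> V \<in> S \<and> \<Union>U = \<Union>V}"
  \<comment> \<open>the class of all representatives of the past set \<open>P\<close>; it is the vertex that \<open>P\<close> corresponds to\<close>
  define cls where "cls P = {V \<in> S. \<Union>V = P}" for P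
  have stripW: "strip a P \<in> ?W" if P: "P \<in> ?W" and ne: "strip a P \<noteq> {}" for a P
  proof -
    obtain w where w: "w \<in> words X" "P = past_of_word X w" using P by blast
    then have "strip a P = past_of_word X (a # w)" by (simp add: past_of_word_Cons)
    moreover from this have "a # w \<in> words X" using ne by (simp add: words_iff)
    ultimately show ?thesis by blast
  qed
  have repr: "\<exists>V\<in>S. \<Union>V = P" if P: "P \<in> ?W" for P
  proof -
    obtain w where w: "w \<in> words X" "P = past_of_word X w" using P by blast
    have ne: "P \<noteq> {}" using w by (simp add: words_iff)
    obtain \<X> where \<X>: "\<X> \<subseteq> Krieger_vertices X" "P = \<Union>\<X>"
      unfolding w(2) using past_of_word_Union_Krieger by blast
    \<comment> \<open>the largest candidate for a representative of \<open>P\<close>\<close>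
    let ?V = "{Q \<in> H. Q \<subseteq> P}"
    have "\<Union>?V = P"
    proof (intro equalityI subsetI)
      fix y assume "y \<in> P"
      then obtain Q where Q: "Q \<in> \<X>" "y \<in> Q" using \<X>(2) by blast
      then obtain Q' where "Q' \<in> H" "y \<in> Q'" "Q' \<subseteq> Q" using gen \<X>(1) by blast
      then show "y \<in> \<Union>?V" using Q(1) \<X>(2) by blast
    qed blast
    moreover from this have "?V \<noteq> {}" using ne by blast
    moreover have "?V \<subseteq> H" by blast
    ultimately have "?V \<in> S" using P by (simp add: S_def)
    then show ?thesis using \<open>\<Union>?V = P\<close> by blast
  qed
  have cls: "cls P \<noteq> {}" if "P \<in> ?W" for P using repr[OF that] by (auto simp: cls_def)
  have SH: "V \<subseteq> H" if "V \<in> S" for V using that by (simp add: S_def)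
  have preS: "preimage (Krieger_part H) a V \<in> S"
    if V: "V \<in> S" and ne: "preimage (Krieger_part H) a V \<noteq> {}" for a V
  proof -
    have "preimage (Krieger_part H) a V \<subseteq> H"
      unfolding preimage_part[OF SH[OF V]] using SH[OF V] strip_closed by auto
    moreover have "strip a (\<Union>V) \<in> ?W"
      using V ne by (intro stripW) (auto simp: S_def preimage_part_empty_iff)
    ultimately show ?thesis using ne SH[OF V] by (simp add: S_def Union_preimage_part)
  qed
  have "past_closed (Krieger_part H) S R"
    unfolding past_closed_def verts_part
  proof (intro conjI ballI allI impI)
    show "S \<subseteq> Pow H - {{}}" by (auto simp: S_def)
    show "equiv S R" by (auto simp: R_def equiv_def refl_on_def sym_def trans_def)
    show "{P} \<in> S" if "P \<in> H" for P
      using that subset past_of_ray_is_past_of_word[OF finite_Krieger]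
      by (auto simp: S_def Krieger_vertices_def)
    show "u = v" if "({u}, {v}) \<in> R" for u v using that by (simp add: R_def)
    show "preimage (Krieger_part H) a V \<in> S"
      if "V \<in> S" "preimage (Krieger_part H) a V \<noteq> {}" for a V using that by (rule preS)
    fix U V a assume UV: "U \<in> S" "V \<in> S" and
      R: "(U, V) \<in> R \<and> preimage (Krieger_part H) a U \<noteq> {}"
    then have eq: "\<Union>U = \<Union>V" by (simp add: R_def)
    have "strip a (\<Union>U) \<noteq> {}"
      using R preimage_part_empty_iff[OF SH[OF UV(1)]] by blast
    then show ne: "preimage (Krieger_part H) a V \<noteq> {}"
      unfolding eq preimage_part_empty_iff[OF SH[OF UV(2)]] .
    show "(preimage (Krieger_part H) a U, preimage (Krieger_part H) a V) \<in> R"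
      using preS[OF UV(1)] preS[OF UV(2) ne] R eq SH[OF UV(1)] SH[OF UV(2)]
      by (simp add: R_def Union_preimage_part)
  qed
  moreover have "labelled_graph_isomorphic (past_set_cover X) (generated_graph (Krieger_part H) S R)"
  proof -
    define T where "T = {(strip a P, a, P) |a P. P \<in> ?W \<and> strip a P \<noteq> {}}"
    have T: "past_set_cover X = graph_of_triples ?W T"
    proof -
      have "a # w \<in> words X \<longleftrightarrow> strip a (past_of_word X w) \<noteq> {}" for a w
        by (simp add: words_iff past_of_word_Cons)
      then have "{(past_of_word X (a # w), a, past_of_word X w) |a w. w \<in> words X \<and> a # w \<in> words X} =
          {(strip a (past_of_word X w), a, past_of_word X w) |a w.
             w \<in> words X \<and> strip a (past_of_word X w) \<noteq> {}}"
        by (simp only: past_of_word_Cons)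
      also have "\<dots> = T" unfolding T_def by fast
      finally show ?thesis by (simp add: past_set_cover_def)
    qed
    have Rcls: "R `` {V} = cls (\<Union>V)" if "V \<in> S" for V
      using that by (auto simp: R_def cls_def)
    have "S // R = cls ` ?W"
    proof (intro set_eqI iffI)
      fix C assume "C \<in> S // R"
      then obtain V where "V \<in> S" "C = R `` {V}" by (auto simp: quotient_def)
      moreover from this have "\<Union>V \<in> ?W" by (simp add: S_def)
      ultimately show "C \<in> cls ` ?W" using Rcls by blast
    next
      fix C assume "C \<in> cls ` ?W"
      then obtain P where P: "P \<in> ?W" "C = cls P" by blast
      obtain V where V: "V \<in> S" "\<Union>V = P" using repr[OF P(1)] by blast
      have "C = R `` {V}" using Rcls[OF V(1)] P(2) V(2) by simp
      then show "C \<in> S // R" using V(1) by (simp add: quotientI)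
    qed
    moreover have "{(R `` {preimage (Krieger_part H) a V}, a, R `` {V}) |a V.
        V \<in> S \<and> preimage (Krieger_part H) a V \<noteq> {}} = (\<lambda>(u, a, v). (cls u, a, cls v)) ` T"
      (is "?L = ?R")
    proof (intro set_eqI iffI)
      fix e assume "e \<in> ?L"
      then obtain a V where V: "V \<in> S" "preimage (Krieger_part H) a V \<noteq> {}"
        and e: "e = (R `` {preimage (Krieger_part H) a V}, a, R `` {V})" by blast
      have "e = (cls (strip a (\<Union>V)), a, cls (\<Union>V))"
        unfolding e using V preS[OF V] SH[OF V(1)] by (simp add: Rcls Union_preimage_part)
      moreover have "(strip a (\<Union>V), a, \<Union>V) \<in> T"
        using V SH[OF V(1)] by (simp add: T_def S_def preimage_part_empty_iff)
      ultimately show "e \<in> ?R" by force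
    next
      fix e assume "e \<in> ?R"
      then obtain a P where P: "P \<in> ?W" "strip a P \<noteq> {}" and e: "e = (cls (strip a P), a, cls P)"
        by (auto simp: T_def)
      obtain V where V: "V \<in> S" "\<Union>V = P" using repr[OF P(1)] by blast
      then have ne: "preimage (Krieger_part H) a V \<noteq> {}"
        using P(2) SH[OF V(1)] by (simp add: preimage_part_empty_iff)
      then have "e = (R `` {preimage (Krieger_part H) a V}, a, R `` {V})"
        unfolding e using V preS[OF V(1) ne] SH[OF V(1)] by (simp add: Rcls Union_preimage_part)
      then show "e \<in> ?L" using V ne by blast
    qed
    ultimately have G: "generated_graph (Krieger_part H) S R =
        graph_of_triples (cls ` ?W) ((\<lambda>(u, a, v). (cls u, a, cls v)) ` T)"
      by (simp add: generated_graph_def)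
    have inj: "inj_on cls ?W"
    proof (rule inj_onI)
      fix P Q assume "P \<in> ?W" "Q \<in> ?W" "cls P = cls Q"
      then obtain V where "V \<in> cls P" "V \<in> cls Q" using cls by blast
      then show "P = Q" by (simp add: cls_def)
    qed
    moreover have "u \<in> ?W \<and> v \<in> ?W" if "(u, a, v) \<in> T" for u a v
      using that stripW unfolding T_def by blast
    ultimately show ?thesis
      unfolding T G by (rule labelled_graph_isomorphic_graph_of_triples)
  qed
  ultimately show ?thesis
    unfolding foundation_def
    using finite_part left_resolving_part predecessor_separated_part by blast
qed

end

section \<open>The two foundations\<close>

context shift
begin

text \<open>A Krieger vertex minimal among those that contain \<open>y\<close> is non-decomposable: in a decomposition
  of it, the part containing \<open>y\<close> is the whole.\<close>

lemma non_decomposable_below: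
  assumes fin: "finite (Krieger_vertices X)" and P: "P \<in> Krieger_vertices X" "y \<in> P"
  shows "\<exists>Q. non_decomposable X Q \<and> y \<in> Q \<and> Q \<subseteq> P"
proof -
  let ?C = "{Q \<in> Krieger_vertices X. y \<in> Q \<and> Q \<subseteq> P}"
  have "\<exists>Q\<in>?C. \<forall>Q'\<in>?C. Q' \<subseteq> Q \<longrightarrow> Q = Q'"
    by (rule finite_has_minimal) (use fin P in auto)
  then obtain Q where QC: "Q \<in> ?C" and "\<forall>Q'\<in>?C. Q' \<subseteq> Q \<longrightarrow> Q = Q'"
    by (rule bexE)
  then have minimal: "Q = Q'" if "Q' \<in> Krieger_vertices X" "y \<in> Q'" "Q' \<subseteq> Q" for Q'
    using that by auto
  have Q: "Q \<in> Krieger_vertices X" "y \<in> Q" "Q \<subseteq> P" using QC by auto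
  have "Q \<in> V" if V: "V \<subseteq> Krieger_vertices X" "Q = \<Union>V" for V
  proof -
    obtain Q' where Q': "Q' \<in> V" "y \<in> Q'" using V(2) Q(2) by auto
    then have "Q = Q'" using V by (intro minimal) auto
    then show ?thesis using Q' by simp
  qed
  then have "non_decomposable X Q" using Q(1) unfolding non_decomposable_def by blast
  then show ?thesis using Q by blast
qed

lemma non_decomposable_in_Fischer: "non_decomposable X P \<Longrightarrow> P \<in> Fischer_vertices X"
  using wf_digraph.reachable_refl[OF wf_Krieger, of P]
  by (auto simp: Fischer_vertices_def non_decomposable_def Krieger_graph)

lemma strip_Fischer_vertex:
  assumes Q: "Q \<in> Fischer_vertices X" and ne: "strip a Q \<noteq> {}"
  shows "strip a Q \<in> Fischer_vertices X"
proof -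
  let ?G = "fst (left_Krieger_cover X)"
  obtain P' where P': "non_decomposable X P'" "Q \<rightarrow>\<^sup>*\<^bsub>?G\<^esub> P'" and QK: "Q \<in> Krieger_vertices X"
    using Q by (auto simp: Fischer_vertices_def)
  have "(strip a Q, a, Q) \<in> arcs ?G" using QK ne by (auto simp: Krieger_arcs)
  then have "arc_to_ends ?G (strip a Q, a, Q) \<in> arcs_ends ?G"
    unfolding arcs_ends_def by (rule imageI)
  then have "strip a Q \<rightarrow>\<^bsub>?G\<^esub> Q"
    by (simp add: arc_to_ends_def Krieger_graph)
  then have "strip a Q \<rightarrow>\<^sup>*\<^bsub>?G\<^esub> P'"
    using P'(2) by (rule wf_digraph.adj_reachable_trans[OF wf_Krieger])
  then show ?thesis
    using P'(1) strip_Krieger_vertex(1)[OF QK ne] by (auto simp: Fischer_vertices_def)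
qed

end

theorem theorem4p8:
  fixes A :: "'a set" and X :: "(int \<Rightarrow> 'a) set"
  assumes "sofic A X"
  shows "foundation (generalized_left_Fischer_cover X) (past_set_cover X) \<and>
         foundation (left_Krieger_cover X) (past_set_cover X)"
proof -
  interpret shift A X
    using assms by unfold_locales (simp add: sofic_def)
  have fin: "finite (Krieger_vertices X)"
    using assms by (rule finite_Krieger_vertices)
  interpret G: Krieger_hereditary A X "Fischer_vertices X"
    by unfold_locales (use fin strip_Fischer_vertex in \<open>auto simp: Fischer_vertices_def\<close>)
  interpret K: Krieger_hereditary A X "Krieger_vertices X"
    by unfold_locales (use fin strip_Krieger_vertex in auto)
  have "foundation (Krieger_part (Fischer_vertices X)) (past_set_cover X)"
  proof (rule G.foundation_part)
    fix P y assume "P \<in> Krieger_vertices X" "y \<in> P"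
    from non_decomposable_below[OF fin this] show "\<exists>Q\<in>Fischer_vertices X. y \<in> Q \<and> Q \<subseteq> P"
      using non_decomposable_in_Fischer by blast
  qed
  moreover have "foundation (Krieger_part (Krieger_vertices X)) (past_set_cover X)"
    by (rule K.foundation_part) blast
  ultimately show ?thesis
    unfolding Krieger_part_all
    by (simp add: Krieger_part_def generalized_left_Fischer_cover_def)
qed

end
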